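(* Let $q=p^m$ be an odd prime power, $p$ an odd prime. With $A_{\alpha,0},A_{\alpha,1}$ ($\alpha\in\mathbb{F}_q$) and $A_2$ the $(q+1)q^2\times(q+1)q^2$ matrices defined in the context, the set of matrices $\{A_{\alpha,0},A_{\alpha,1},A_2\mid\alpha\in\mathbb{F}_q\}$ forms a non-commutative association scheme.
   Context: $I_r$ and $J_r$ are the identity and all-ones matrices of order $r$. A set of nonzero $v\times v$ $(0,1)$-matrices $\{A_0,\dots,A_d\}$ is an association scheme if $A_0=I_v$ (for one labelled $A_0$), $\sum_iA_i=J_v$, $A_i^\top\in\{A_1,\dots,A_d\}$ for $i\ge1$, and every product $A_iA_j$ is a linear combination of $A_0,\dots,A_d$. It is commutative if $A_iA_j=A_jA_i$ for all $i,j$, and non-commutative otherwise. Identify the additive group of $\mathbb{F}_q$ with $\mathbb{F}_p^m=\mathbb{Z}_p^m$, its elements being ordered lexicographically (coordinates in $0<1<\dots<p-1$). Let $U$ be the $p\times p$ circulant matrix with first row $(0,1,0,\dots,0)$, and $\phi((x_i)_{i=1}^m)=\bigotimes_{i=1}^mU^{x_i}$, a $q\times q$ permutation matrix. For $\alpha,\alpha'\in\mathbb{F}_q$ let $C_{\alpha,\alpha'}=(\phi(\alpha(-\beta+\beta')+\alpha'))_{\beta,\beta'\in\mathbb{F}_q}$, a $q^2\times q^2$ $(0,1)$-matrix made of $q\times q$ blocks. For an indeterminate $x$, let $C_{x,\alpha}=J_{q^2}-I_q\otimes J_q$ for all $\alpha\in\mathbb{F}_q$. Let $L=(L(a,a'))_{a,a'\in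 S}$ be a symmetric Latin square of order $q+1$ on the symbol set $S=\mathbb{F}_q\cup\{x\}$ with constant diagonal $x$, and write $L=\sum_{a\in S}a\cdot P_a$, where $P_a$ is the symmetric permutation matrix of order $q+1$ marking the positions of the symbol $a$ (so $P_x=I_{q+1}$). Let $R$ be the back identity matrix of order $q^2$ (ones on the anti-diagonal). For $\alpha\in\mathbb{F}_q$ let $N_\alpha=I_{q+1}\otimes(J_{q^2}-I_q\otimes J_q)+\sum_{a\in\mathbb{F}_q}P_a\otimes C_{a,\alpha}R$. Define $$A_{\alpha,0}=I_{q(q+1)}\otimes\phi(\alpha),\quad A_{\alpha,1}=N_\alpha-I_{q+1}\otimes(J_{q^2}-I_q\otimes J_q),\quad A_2=I_{q+1}\otimes(J_{q^2}-I_q\otimes J_q).$$ *)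

theory Defs
  imports Complex_Main "HOL-Computational_Algebra.Primes" "Jordan_Normal_Form.Matrix"
begin

section \<open>Matrix notation\<close>

definition all_ones_mat :: "nat \<Rightarrow> complex mat" where
  "all_ones_mat n = mat n n (\<lambda>_. 1)"

definition back_identity_mat :: "nat \<Rightarrow> complex mat" where
  "back_identity_mat n = mat n n (\<lambda>(i, j). if i + j + 1 = n then 1 else 0)"

definition kronecker :: "complex mat \<Rightarrow> complex mat \<Rightarrow> complex mat" (infixr \<open>\<otimes>\<^sub>k\<close> 72) where
  "A \<otimes>\<^sub>k B = mat (dim_row A * dim_row B) (dim_col A * dim_col B)
     (\<lambda>(i, j). A $$ (i div dim_row B, j div dim_col B) * B $$ (i mod dim_row B, j mod dim_col B))"

text \<open>Sum of a finite family of square matrices of order \<open>n\<close>; the type of matrices of all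
  dimensions is not a \<open>comm_monoid_add\<close>, so the sum is taken entrywise.\<close>

definition mat_sum :: "nat \<Rightarrow> ('i \<Rightarrow> complex mat) \<Rightarrow> 'i set \<Rightarrow> complex mat" where
  "mat_sum n f I = mat n n (\<lambda>ij. \<Sum>i\<in>I. f i $$ ij)"

section \<open>Association schemes\<close>

definition association_scheme :: "nat \<Rightarrow> complex mat set \<Rightarrow> bool" where
  "association_scheme v \<A> \<longleftrightarrow>
     finite \<A> \<and> \<A> \<subseteq> carrier_mat v v \<and>
     (\<forall>A\<in>\<A>. A \<noteq> 0\<^sub>m v v \<and> elements_mat A \<subseteq> {0, 1}) \<and>
     1\<^sub>m v \<in> \<A> \<and>
     mat_sum v (\<lambda>A. A) \<A> = all_ones_mat v \<and>
     (\<forall>A\<in>\<A> - {1\<^sub>m v}. transpose_mat A \<in> \<A> - {1\<^sub>m v}) \<and>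
     (\<forall>A\<in>\<A>. \<forall>B\<in>\<A>. \<exists>c :: complex mat \<Rightarrow> complex.
        A * B = mat_sum v (\<lambda>M. c M \<cdot>\<^sub>m M) \<A>)"

definition commutative_scheme :: "nat \<Rightarrow> complex mat set \<Rightarrow> bool" where
  "commutative_scheme v \<A> \<longleftrightarrow> association_scheme v \<A> \<and> (\<forall>A\<in>\<A>. \<forall>B\<in>\<A>. A * B = B * A)"

definition noncommutative_scheme :: "nat \<Rightarrow> complex mat set \<Rightarrow> bool" where
  "noncommutative_scheme v \<A> \<longleftrightarrow> association_scheme v \<A> \<and> \<not> commutative_scheme v \<A>"

section \<open>The finite field and its lexicographic ordering\<close>

text \<open>\<open>c\<close> identifies the additive group of the field with \<open>\<int>\<^sub>p\<^sup>m\<close>; coordinate vectors are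
  lists of length \<open>m\<close> over \<open>{0,\<dots>,p-1}\<close>.\<close>

definition coordinates :: "nat \<Rightarrow> nat \<Rightarrow> ('a::{field,finite} \<Rightarrow> nat list) \<Rightarrow> bool" where
  "coordinates p m c \<longleftrightarrow>
     bij_betw c UNIV {xs. length xs = m \<and> set xs \<subseteq> {0..<p}} \<and>
     (\<forall>x y. c (x + y) = map2 (\<lambda>i j. (i + j) mod p) (c x) (c y))"

definition lex_rank :: "('a::{field,finite} \<Rightarrow> nat list) \<Rightarrow> 'a \<Rightarrow> nat" where
  "lex_rank c x = card {y. (c y, c x) \<in> lexord less_than}"

text \<open>\<open>nth_elem c k\<close> is the \<open>k\<close>-th field element in lexicographic order, counting from 0.\<close>

definition nth_elem :: "('a::{field,finite} \<Rightarrow> nat list) \<Rightarrow> nat \<Rightarrow> 'a" where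
  "nth_elem c k = (THE x. lex_rank c x = k)"

section \<open>The matrices \<open>\<phi>(\<alpha>)\<close> and \<open>C\<^sub>\<alpha>\<^sub>,\<^sub>\<alpha>\<^sub>'\<close>\<close>

definition circulant_U :: "nat \<Rightarrow> complex mat" where
  "circulant_U p = mat p p (\<lambda>(i, j). if j = (i + 1) mod p then 1 else 0)"

definition phi :: "nat \<Rightarrow> ('a::{field,finite} \<Rightarrow> nat list) \<Rightarrow> 'a \<Rightarrow> complex mat" where
  "phi p c x = foldr (\<lambda>k M. (circulant_U p ^\<^sub>m k) \<otimes>\<^sub>k M) (c x) (1\<^sub>m 1)"

text \<open>The \<open>q \<times> q\<close> block of \<open>C_block\<close> in block position \<open>(b, b')\<close> belongs to the \<open>b\<close>-th and the
  \<open>b'\<close>-th field element.\<close>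

definition C_block :: "nat \<Rightarrow> nat \<Rightarrow> ('a::{field,finite} \<Rightarrow> nat list) \<Rightarrow> 'a \<Rightarrow> 'a \<Rightarrow> complex mat" where
  "C_block p q c \<alpha> \<alpha>' = mat (q\<^sup>2) (q\<^sup>2)
     (\<lambda>(i, j). phi p c (\<alpha> * (- nth_elem c (i div q) + nth_elem c (j div q)) + \<alpha>')
                 $$ (i mod q, j mod q))"

text \<open>The matrix \<open>C\<^sub>x\<^sub>,\<^sub>\<alpha>\<close> for the extra symbol \<open>x\<close>; it does not depend on \<open>\<alpha>\<close>.\<close>

definition C_x :: "nat \<Rightarrow> complex mat" where
  "C_x q = all_ones_mat (q\<^sup>2) - 1\<^sub>m q \<otimes>\<^sub>k all_ones_mat q"

section \<open>Latin squares\<close>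

text \<open>The symbol set \<open>\<F>\<^sub>q \<union> {x}\<close> is the type \<open>'a option\<close>, with \<open>None\<close> for \<open>x\<close>; it also indexes
  the rows and columns.\<close>

definition latin_square :: "('s \<Rightarrow> 's \<Rightarrow> 's) \<Rightarrow> bool" where
  "latin_square L \<longleftrightarrow> (\<forall>a. bij (L a)) \<and> (\<forall>b. bij (\<lambda>a. L a b))"

text \<open>\<open>e\<close> lists the index set as \<open>e 0, \<dots>, e q\<close>.\<close>

definition P_mat :: "nat \<Rightarrow> (nat \<Rightarrow> 'a option) \<Rightarrow> ('a option \<Rightarrow> 'a option \<Rightarrow> 'a option) \<Rightarrow>
    'a option \<Rightarrow> complex mat" where
  "P_mat q e L a = mat (q + 1) (q + 1) (\<lambda>(i, j). if L (e i) (e j) = a then 1 else 0)"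

section \<open>The matrices of the scheme\<close>

definition N_mat :: "nat \<Rightarrow> nat \<Rightarrow> ('a::{field,finite} \<Rightarrow> nat list) \<Rightarrow> (nat \<Rightarrow> 'a option) \<Rightarrow>
    ('a option \<Rightarrow> 'a option \<Rightarrow> 'a option) \<Rightarrow> 'a \<Rightarrow> complex mat" where
  "N_mat p q c e L \<alpha> = 1\<^sub>m (q + 1) \<otimes>\<^sub>k C_x q +
     mat_sum ((q + 1) * q\<^sup>2)
       (\<lambda>a. P_mat q e L (Some a) \<otimes>\<^sub>k (C_block p q c a \<alpha> * back_identity_mat (q\<^sup>2))) UNIV"

definition A0_mat :: "nat \<Rightarrow> nat \<Rightarrow> ('a::{field,finite} \<Rightarrow> nat list) \<Rightarrow> 'a \<Rightarrow> complex mat" where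
  "A0_mat p q c \<alpha> = 1\<^sub>m (q * (q + 1)) \<otimes>\<^sub>k phi p c \<alpha>"

definition A1_mat :: "nat \<Rightarrow> nat \<Rightarrow> ('a::{field,finite} \<Rightarrow> nat list) \<Rightarrow> (nat \<Rightarrow> 'a option) \<Rightarrow>
    ('a option \<Rightarrow> 'a option \<Rightarrow> 'a option) \<Rightarrow> 'a \<Rightarrow> complex mat" where
  "A1_mat p q c e L \<alpha> = N_mat p q c e L \<alpha> - 1\<^sub>m (q + 1) \<otimes>\<^sub>k C_x q"

definition A2_mat :: "nat \<Rightarrow> complex mat" where
  "A2_mat q = 1\<^sub>m (q + 1) \<otimes>\<^sub>k C_x q"

end

theory Submission
  imports Defs "HOL-Number_Theory.Residues"
begin

text \<open>
  All the matrices of the family are read as one colouring of pairs of points. Put \<open>K\<close> for the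
  field. The row index \<open>i\<close> of order \<open>(q + 1) q\<^sup>2\<close> stands for a point \<open>(l, b, r)\<close> with
  \<open>l \<in> K \<union> {x}\<close> and \<open>b, r \<in> K\<close>, namely the positions of the outer block, of the inner
  block and of the entry inside the inner block. Reversing the lexicographic order of \<open>K\<close>
  replaces every coordinate \<open>t\<close> by \<open>p - 1 - t\<close>, so it is the map \<open>y \<mapsto> w - y\<close>, where \<open>w\<close> is
  the last element of \<open>K\<close>. Hence multiplication by the back identity substitutes
  \<open>(w - b', w - r')\<close> for the column coordinates \<open>(b', r')\<close>, and the entries of the matrices become

    \<^item> \<open>A\<^sub>d\<^sub>,\<^sub>0\<close>: \<open>l = l'\<close>, \<open>b = b'\<close> and \<open>r' - r = d\<close>;

    \<^item> \<open>A\<^sub>2\<close>: \<open>l = l'\<close> and \<open>b \<noteq> b'\<close>;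

    \<^item> \<open>A\<^sub>d\<^sub>,\<^sub>1\<close>: \<open>L l l' = a \<in> K\<close> and \<open>w - r - r' - a (w - b - b') = d\<close>.

  Since the symbol \<open>x\<close> occurs in \<open>L\<close> exactly on the diagonal, every pair of points satisfies
  exactly one of these conditions: its colour (\<open>point_colour\<close>). The scheme axioms then say that
  the colour of \<open>(y, x)\<close> is determined by that of \<open>(x, y)\<close>, which is clear from the symmetry of
  \<open>L\<close>, and that the number of \<open>z\<close> with prescribed colours of \<open>(x, z)\<close> and \<open>(z, y)\<close> depends only
  on the colour of \<open>(x, y)\<close> (\<open>coherent\<close>, turned into a scheme by
  \<open>association_scheme_of_colouring\<close>).

  The decisive count is that of \<open>card_Cross_Cross\<close>. For \<open>x = (l, b, r)\<close>, \<open>y = (l', b', r')\<close> and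
  \<open>z = (l'', b'', r'')\<close>, put \<open>s = L l l''\<close> and \<open>s' = L l' l''\<close>. One of the two conditions
  determines \<open>r''\<close>; what is left of the other is
  \<open>r' - r = d - d' + s (w - b - b'') - s' (w - b' - b'')\<close>. If \<open>l \<noteq> l'\<close> then \<open>s \<noteq> s'\<close>,
  and the equation has exactly one solution \<open>b''\<close> for each of the \<open>q - 1\<close> possible \<open>l''\<close>. If
  \<open>l = l'\<close> then \<open>s = s'\<close>, the unknown \<open>b''\<close> cancels, and the equation reads
  \<open>r' - r = d - d' - s (b - b')\<close>: for \<open>b \<noteq> b'\<close> it determines \<open>s\<close>, hence \<open>l''\<close>, leaving \<open>q\<close>
  choices of \<open>b''\<close>; for \<open>b = b'\<close> it holds for all \<open>q\<^sup>2\<close> choices or for none.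

  Non-commutativity comes from the reversal as well: the colour of a \<open>Cross\<close> pair depends on the
  sum \<open>r + r'\<close>, whereas that of a \<open>Within\<close> pair is the difference \<open>r' - r\<close>. So a \<open>Within 1\<close> step
  taken before or after a \<open>Cross\<close> step changes the resulting colour by opposite amounts: the product
  \<open>A\<^sub>1\<^sub>,\<^sub>0 A\<^sub>0\<^sub>,\<^sub>1\<close> is the matrix of colour \<open>Cross 1\<close>, but \<open>A\<^sub>0\<^sub>,\<^sub>1 A\<^sub>1\<^sub>,\<^sub>0\<close> is that of \<open>Cross (- 1)\<close>,
  and \<open>1 \<noteq> - 1\<close> in odd characteristic.
\<close>

section \<open>Association schemes from colourings of pairs\<close>

definition colour_mat :: "nat \<Rightarrow> (nat \<Rightarrow> 'x) \<Rightarrow> ('x \<Rightarrow> 'x \<Rightarrow> 'k) \<Rightarrow> 'k \<Rightarrow> complex mat" where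
  "colour_mat v h \<chi> k = mat v v (\<lambda>(i, j). of_bool (\<chi> (h i) (h j) = k))"

lemma colour_mat_index [simp]:
  "i < v \<Longrightarrow> j < v \<Longrightarrow> colour_mat v h \<chi> k $$ (i, j) = of_bool (\<chi> (h i) (h j) = k)"
  by (simp add: colour_mat_def)

lemma colour_mat_dim [simp]:
  "dim_row (colour_mat v h \<chi> k) = v" "dim_col (colour_mat v h \<chi> k) = v"
  by (simp_all add: colour_mat_def)

lemma bij_betw_index:
  assumes "bij_betw h {0..<v} UNIV"
  obtains i where "i < v" "h i = x"
  using assms by (metis UNIV_I atLeastLessThan_iff bij_betw_imp_surj_on imageE)

lemma colour_mat_inj:
  assumes h: "bij_betw h {0..<v} UNIV"
    and surj: "\<And>k. \<exists>x y. \<chi> x y = k"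
  shows "inj (colour_mat v h \<chi>)"
proof (rule injI)
  fix k l assume eq: "colour_mat v h \<chi> k = colour_mat v h \<chi> l"
  obtain x y where xy: "\<chi> x y = k" using surj by blast
  obtain i j where ij: "i < v" "j < v" "h i = x" "h j = y"
    using bij_betw_index[OF h] by metis
  have "colour_mat v h \<chi> l $$ (i, j) = 1"
    unfolding eq[symmetric] using xy ij by simp
  then show "k = l" using ij xy by (auto split: if_splits)
qed

lemma colour_mat_mult_index:
  assumes h: "bij_betw h {0..<v} UNIV" and ij: "i < v" "j < v"
  shows "(colour_mat v h \<chi> k * colour_mat v h \<chi> l) $$ (i, j)
    = of_nat (card {z. \<chi> (h i) z = k \<and> \<chi> z (h j) = l})"
proof -
  have "(colour_mat v h \<chi> k * colour_mat v h \<chi> l) $$ (i, j)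
     = (\<Sum>s\<in>{0..<v}. of_bool (\<chi> (h i) (h s) = k \<and> \<chi> (h s) (h j) = l))"
  proof -
    have "(colour_mat v h \<chi> k * colour_mat v h \<chi> l) $$ (i, j)
        = row (colour_mat v h \<chi> k) i \<bullet> col (colour_mat v h \<chi> l) j"
      using ij by simp
    also have "\<dots> = (\<Sum>s\<in>{0..<v}. of_bool (\<chi> (h i) (h s) = k \<and> \<chi> (h s) (h j) = l))"
      unfolding scalar_prod_def using ij by (intro sum.cong) auto
    finally show ?thesis .
  qed
  also have "\<dots> = (\<Sum>z\<in>UNIV. of_bool (\<chi> (h i) z = k \<and> \<chi> z (h j) = l))"
    by (rule sum.reindex_bij_betw[OF h])
  also have "\<dots> = of_nat (card {z. \<chi> (h i) z = k \<and> \<chi> z (h j) = l})"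
  proof -
    have "finite (UNIV :: 'a set)" using h bij_betw_finite by blast
    then show ?thesis by (simp add: of_bool_def sum.If_cases)
  qed
  finally show ?thesis .
qed

text \<open>
  A product entry of two colour matrices counts the points \<open>z\<close> between a row and a column, so the
  counting hypothesis is exactly closure of the linear span under products. The map \<open>conv\<close> makes the
  family closed under transposition; being an involution, transposition also preserves the set of
  colours other than \<open>k\<^sub>0\<close>. Surjectivity ensures that no matrix of the family vanishes and that distinct
  colours have distinct matrices, so that summing over the set of matrices is summing over colours.
\<close>

lemma association_scheme_of_colouring:
  fixes \<chi> :: "'x \<Rightarrow> 'x \<Rightarrow> 'k"
  assumes h: "bij_betw h {0..<v} UNIV"
    and surj: "\<And>k. \<exists>x y. \<chi> x y = k"
    and diag: "\<And>x y. \<chi> x y = k\<^sub>0 \<longleftrightarrow> x = y"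
    and conv: "\<And>x y. \<chi> y x = conv (\<chi> x y)"
    and conv_conv: "\<And>k. conv (conv k) = k"
    and coherent: "\<And>k l. \<exists>n. \<forall>x y. card {z. \<chi> x z = k \<and> \<chi> z y = l} = n (\<chi> x y)"
  shows "association_scheme v (range (colour_mat v h \<chi>))"
proof -
  let ?M = "colour_mat v h \<chi>"
  have finX: "finite (UNIV :: 'x set)" using h bij_betw_finite by blast
  have "k \<in> (\<lambda>(x, y). \<chi> x y) ` UNIV" for k
    using surj[of k] by auto
  then have "(UNIV :: 'k set) = (\<lambda>(x, y). \<chi> x y) ` UNIV" by blast
  then have fin: "finite (UNIV :: 'k set)"
    using finX by (metis UNIV_Times_UNIV finite_SigmaI finite_imageI)
  have inj: "inj ?M" by (rule colour_mat_inj[OF h surj])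
  have hinj: "h i = h j \<longleftrightarrow> i = j" if "i < v" "j < v" for i j
    using h that by (auto simp: bij_betw_def inj_on_def)
  have one: "?M k\<^sub>0 = 1\<^sub>m v"
    by (rule eq_matI) (auto simp: diag hinj)
  (* At each entry exactly one matrix of the family is nonzero, namely that of the entry's colour. *)
  have comb: "mat_sum v (\<lambda>A. c A \<cdot>\<^sub>m A) (range ?M) $$ (i, j) = c (?M (\<chi> (h i) (h j)))"
    if "i < v" "j < v" for c i j
  proof -
    have "mat_sum v (\<lambda>A. c A \<cdot>\<^sub>m A) (range ?M) $$ (i, j)
        = (\<Sum>k\<in>UNIV. c (?M k) * of_bool (\<chi> (h i) (h j) = k))"
      using that by (simp add: mat_sum_def sum.reindex[OF inj])
    also have "\<dots> = c (?M (\<chi> (h i) (h j)))"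
      using fin by (simp add: of_bool_def if_distrib cong: if_cong)
    finally show ?thesis .
  qed
  have transp: "transpose_mat (?M k) = ?M (conv k)" for k
  proof (rule eq_matI)
    fix i j assume "i < dim_row (?M (conv k))" "j < dim_col (?M (conv k))"
    moreover have "\<chi> (h j) (h i) = k \<longleftrightarrow> \<chi> (h i) (h j) = conv k"
      by (metis conv conv_conv)
    ultimately show "transpose_mat (?M k) $$ (i, j) = ?M (conv k) $$ (i, j)" by simp
  qed simp_all
  have nonzero: "?M k \<noteq> 0\<^sub>m v v" for k
  proof
    assume z: "?M k = 0\<^sub>m v v"
    obtain x y where xy: "\<chi> x y = k" using surj by blast
    obtain i j where ij: "i < v" "j < v" "h i = x" "h j = y"
      using bij_betw_index[OF h] by metis
    then have "?M k $$ (i, j) = 1" using xy by simp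
    then show False using z ij by simp
  qed
  show ?thesis
    unfolding association_scheme_def
  proof (intro conjI ballI)
    show "finite (range ?M)" using fin by simp
    show "range ?M \<subseteq> carrier_mat v v" by auto
    show "1\<^sub>m v \<in> range ?M" using one by (metis rangeI)
    show "mat_sum v (\<lambda>A. A) (range ?M) = all_ones_mat v"
    proof (rule eq_matI)
      fix i j assume "i < dim_row (all_ones_mat v)" "j < dim_col (all_ones_mat v)"
      then have ij: "i < v" "j < v" by (simp_all add: all_ones_mat_def)
      have "mat_sum v (\<lambda>A. A) (range ?M) $$ (i, j) = (\<Sum>k\<in>UNIV. of_bool (\<chi> (h i) (h j) = k))"
        using ij by (simp add: mat_sum_def sum.reindex[OF inj])
      also have "\<dots> = 1" using fin by (simp add: of_bool_def)
      finally show "mat_sum v (\<lambda>A. A) (range ?M) $$ (i, j) = all_ones_mat v $$ (i, j)"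
        using ij by (simp add: all_ones_mat_def)
    qed (simp_all add: mat_sum_def all_ones_mat_def)
  next
    fix A assume "A \<in> range ?M"
    then obtain k where k: "A = ?M k" by blast
    show "A \<noteq> 0\<^sub>m v v" using nonzero k by simp
    show "elements_mat A \<subseteq> {0, 1}" by (auto simp: k elements_mat_def)
  next
    fix A assume "A \<in> range ?M - {1\<^sub>m v}"
    then obtain k where k: "A = ?M k" "A \<noteq> 1\<^sub>m v" by blast
    have "transpose_mat A \<noteq> 1\<^sub>m v"
      using k(2) by (metis transpose_transpose transpose_one)
    then show "transpose_mat A \<in> range ?M - {1\<^sub>m v}" using k transp by simp
  next
    fix A B assume "A \<in> range ?M" "B \<in> range ?M"
    then obtain k l where kl: "A = ?M k" "B = ?M l" by blast
    obtain n where n: "\<And>x y. card {z. \<chi> x z = k \<and> \<chi> z y = l} = n (\<chi> x y)"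
      using coherent by blast
    define coef where "coef D = (of_nat (n (inv_into UNIV ?M D)) :: complex)" for D
    have coef: "coef (?M t) = of_nat (n t)" for t
      unfolding coef_def by (simp only: inv_f_f[OF inj])
    have "A * B = mat_sum v (\<lambda>D. coef D \<cdot>\<^sub>m D) (range ?M)"
    proof (rule eq_matI)
      fix i j
      assume "i < dim_row (mat_sum v (\<lambda>D. coef D \<cdot>\<^sub>m D) (range ?M))"
        "j < dim_col (mat_sum v (\<lambda>D. coef D \<cdot>\<^sub>m D) (range ?M))"
      then have ij: "i < v" "j < v" by (simp_all add: mat_sum_def)
      have "(A * B) $$ (i, j) = of_nat (n (\<chi> (h i) (h j)))"
        by (simp only: kl colour_mat_mult_index[OF h ij] n)
      then show "(A * B) $$ (i, j) = mat_sum v (\<lambda>D. coef D \<cdot>\<^sub>m D) (range ?M) $$ (i, j)"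
        by (simp only: comb[OF ij] coef)
    qed (simp_all add: mat_sum_def kl)
    then show "\<exists>c. A * B = mat_sum v (\<lambda>D. c D \<cdot>\<^sub>m D) (range ?M)" by blast
  qed
qed

section \<open>The colouring of pairs of points\<close>

text \<open>
  The three constructors correspond to \<open>A\<^sub>d\<^sub>,\<^sub>0\<close>, \<open>A\<^sub>2\<close> and \<open>A\<^sub>d\<^sub>,\<^sub>1\<close>: two points in the same class of
  size \<open>q\<close>, in different classes of the same group of size \<open>q\<^sup>2\<close>, or in different groups.
\<close>

datatype 'a colour = Within 'a | Group | Cross 'a

type_synonym 'a point = "'a option \<times> 'a \<times> 'a"

fun point_colour :: "('a option \<Rightarrow> 'a option \<Rightarrow> 'a option) \<Rightarrow> 'a \<Rightarrow> 'a point \<Rightarrow> 'a point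
    \<Rightarrow> 'a::field colour" where
  "point_colour L w (l, b, r) (l', b', r') = (case L l l' of
     None \<Rightarrow> if b = b' then Within (r' - r) else Group
   | Some a \<Rightarrow> Cross (w - r - r' - a * (w - b - b')))"

declare point_colour.simps [simp del]

fun conv_colour :: "'a::field colour \<Rightarrow> 'a colour" where
  "conv_colour (Within d) = Within (- d)"
| "conv_colour Group = Group"
| "conv_colour (Cross d) = Cross d"

text \<open>
  How colours change when the point \<open>(l, b, r)\<close> on the left is replaced by its translate
  \<open>(l, b, r + d)\<close>: a pair whose colour afterwards is \<open>k\<close> had colour \<open>shift_colour d k\<close> before.
\<close>

fun shift_colour :: "'a::field \<Rightarrow> 'a colour \<Rightarrow> 'a colour" where
  "shift_colour d (Within g) = Within (d + g)"
| "shift_colour d Group = Group"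
| "shift_colour d (Cross g) = Cross (d + g)"

locale symmetric_latin_square =
  fixes L :: "'a::{field,finite} option \<Rightarrow> 'a option \<Rightarrow> 'a option" and w :: 'a and q :: nat
  assumes card_UNIV [simp]: "card (UNIV :: 'a set) = q"
    and latin: "latin_square L"
    and L_sym: "\<And>a b. L a b = L b a"
    and L_diag: "\<And>a. L a a = None"
begin

abbreviation "\<chi> \<equiv> point_colour L w"

lemma card_option: "card (UNIV :: 'a option set) = q + 1"
  by (simp add: UNIV_option_conv card_image)

lemma L_inj: "L a b = L a b' \<longleftrightarrow> b = b'"
  using latin by (metis bij_pointE latin_square_def)

lemma L_None: "L a b = None \<longleftrightarrow> a = b"
  using L_inj[of a b a] L_diag by auto

lemma L_surj: "\<exists>b. L a b = s"
  using latin by (metis bij_pointE latin_square_def)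

lemma L_Some: "a \<noteq> b \<Longrightarrow> \<exists>s. L a b = Some s"
  using L_None by (cases "L a b") auto

lemma Cross_eq_iff: "Cross (w - r - r' - u) = Cross d \<longleftrightarrow> r' = w - d - r - u"
proof -
  have "r' = w - (w - r - r' - u) - r - u" and "d = w - r - (w - d - r - u) - u"
    by simp_all
  then show ?thesis by auto
qed

lemma colour_Within: "\<chi> (l, b, r) (l', b', r') = Within d \<longleftrightarrow> l = l' \<and> b = b' \<and> r' = r + d"
  using L_None[of l l'] by (cases "L l l'") (auto simp: point_colour.simps diff_eq_eq add.commute)

lemma colour_Group: "\<chi> (l, b, r) (l', b', r') = Group \<longleftrightarrow> l = l' \<and> b \<noteq> b'"
  using L_None[of l l'] by (cases "L l l'") (auto simp: point_colour.simps)

lemma colour_Cross: "\<chi> (l, b, r) (l', b', r') = Cross d \<longleftrightarrow>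
    (\<exists>a. L l l' = Some a \<and> r' = w - d - r - a * (w - b - b'))"
  by (cases "L l l'") (simp_all add: point_colour.simps Cross_eq_iff del: colour.inject)

lemma colour_diag: "\<chi> x y = Within 0 \<longleftrightarrow> x = y"
  by (cases x; cases y) (auto simp: colour_Within)

lemma colour_conv: "\<chi> y x = conv_colour (\<chi> x y)"
  by (cases x; cases y) (auto split: option.split simp: point_colour.simps L_sym algebra_simps)

lemma conv_conv: "conv_colour (conv_colour k) = k" for k :: "'a colour"
  by (cases k) auto

lemma colour_surj: "\<exists>x y. \<chi> x y = k"
proof (cases k)
  case (Within d)
  have "\<chi> (None, 0, 0) (None, 0, d) = k" unfolding Within colour_Within by simp
  then show ?thesis by blast
next
  case Group
  have "\<chi> (None, 0, 0) (None, 1, 0) = k" unfolding Group colour_Group by simp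
  then show ?thesis by blast
next
  case (Cross d)
  obtain a where "L None (Some 0) = Some a" using L_Some by blast
  then have "\<chi> (None, 0, 0) (Some 0, 0, w - d - a * w) = k"
    unfolding Cross colour_Cross by simp
  then show ?thesis by blast
qed

text \<open>
  The \<open>Within d\<close> matrix is a permutation matrix: the intermediate point is the translate of \<open>x\<close>.
\<close>

lemma card_Within:
  "card {z. \<chi> x z = Within d \<and> \<chi> z y = l} = of_bool (\<chi> x y = shift_colour d l)"
proof -
  obtain a b r where x: "x = (a, b, r)" by (cases x)
  obtain a' b' r' where y: "y = (a', b', r')" by (cases y)
  have "\<chi> (a, b, r + d) y = l \<longleftrightarrow> \<chi> x y = shift_colour d l"
    unfolding x y by (cases l; cases "L a a'") (auto simp: point_colour.simps algebra_simps)
  moreover have "{z. \<chi> x z = Within d \<and> \<chi> z y = l}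
      = (if \<chi> (a, b, r + d) y = l then {(a, b, r + d)} else {})"
    unfolding x by (auto simp: colour_Within)
  ultimately show ?thesis by simp
qed

lemma card_Group_Group:
  "card {z. \<chi> x z = Group \<and> \<chi> z y = Group} =
    (case \<chi> x y of Within d \<Rightarrow> (q - 1) * q | Group \<Rightarrow> (q - 2) * q | Cross d \<Rightarrow> 0)"
proof -
  obtain a b r where x: "x = (a, b, r)" by (cases x)
  obtain a' b' r' where y: "y = (a', b', r')" by (cases y)
  have S: "{z. \<chi> x z = Group \<and> \<chi> z y = Group} =
      (if a = a' then {a} \<times> (UNIV - {b, b'}) \<times> UNIV else {})"
    unfolding x y by (auto simp: colour_Group)
  have c: "card (UNIV - {b, b'}) = q - (if b = b' then 1 else 2)"
    by (subst card_Diff_subset) auto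
  show ?thesis
  proof (cases "a = a'")
    case True
    then have "\<chi> x y = (if b = b' then Within (r' - r) else Group)"
      by (simp add: x y point_colour.simps L_diag)
    then show ?thesis using True c by (simp add: S card_cartesian_product)
  next
    case False
    then obtain s where "L a a' = Some s" using L_Some by blast
    then have "\<chi> x y = Cross (w - r - r' - s * (w - b - b'))"
      by (simp add: x y point_colour.simps)
    then show ?thesis using False by (simp add: S)
  qed
qed

text \<open>
  The intermediate point lies in the group of \<open>y\<close> but not in its class; each other class of that
  group contains exactly one point of the required colour from \<open>x\<close>, provided \<open>x\<close> lies elsewhere.
\<close>

lemma card_Cross_Group:
  "card {z. \<chi> x z = Cross d \<and> \<chi> z y = Group} =
    (case \<chi> x y of Cross d \<Rightarrow> q - 1 | _ \<Rightarrow> 0)"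
proof -
  obtain a b r where x: "x = (a, b, r)" by (cases x)
  obtain a' b' r' where y: "y = (a', b', r')" by (cases y)
  show ?thesis
  proof (cases "a = a'")
    case True
    then have "{z. \<chi> x z = Cross d \<and> \<chi> z y = Group} = {}"
      unfolding x y by (auto simp: colour_Group colour_Cross L_diag)
    moreover have "\<chi> x y = (if b = b' then Within (r' - r) else Group)"
      using True by (simp add: x y point_colour.simps L_diag)
    ultimately show ?thesis by simp
  next
    case False
    then obtain s where s: "L a a' = Some s" using L_Some by blast
    have "{z. \<chi> x z = Cross d \<and> \<chi> z y = Group} =
        (\<lambda>b''. (a', b'', w - d - r - s * (w - b - b''))) ` (UNIV - {b'})"
      unfolding x y using s by (auto simp: colour_Group colour_Cross)
    also have "card \<dots> = q - 1"
      by (subst card_image) (auto simp: inj_on_def)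
    finally have "card {z. \<chi> x z = Cross d \<and> \<chi> z y = Group} = q - 1" .
    moreover have "\<chi> x y = Cross (w - r - r' - s * (w - b - b'))"
      using s by (simp add: x y point_colour.simps)
    ultimately show ?thesis by simp
  qed
qed

text \<open>
  The count behind the scheme: after \<open>r''\<close> is eliminated, the remaining condition is a linear
  equation in the slopes \<open>s = L a a''\<close>, \<open>s' = L a' a''\<close> and in \<open>b''\<close>. Field division solves it for
  \<open>b''\<close> when \<open>a \<noteq> a'\<close>, and for the common slope \<open>s = s'\<close> when \<open>a = a'\<close> and \<open>b \<noteq> b'\<close>; a slope is
  realised by exactly one \<open>a''\<close> because \<open>L\<close> is a Latin square.
\<close>

lemma card_Cross_Cross:
  "card {z. \<chi> x z = Cross d \<and> \<chi> z y = Cross d'} =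
    (case \<chi> x y of Within g \<Rightarrow> if g = d - d' then q * q else 0 | Group \<Rightarrow> q | Cross g \<Rightarrow> q - 1)"
proof -
  obtain a b r where x: "x = (a, b, r)" by (cases x)
  obtain a' b' r' where y: "y = (a', b', r')" by (cases y)
  let ?Z = "{z. \<chi> x z = Cross d \<and> \<chi> z y = Cross d'}"
  (* The third coordinate of z forced by the colour of (x, z). *)
  define f where "f s b'' = w - d - r - s * (w - b - b'')" for s b''
  have Z: "(a'', b'', r'') \<in> ?Z \<longleftrightarrow> (\<exists>s s'. L a a'' = Some s \<and> L a' a'' = Some s' \<and>
      r'' = f s b'' \<and> r' - r = d - d' + s * (w - b - b'') - s' * (w - b' - b''))" for a'' b'' r''
  proof -
    have e: "w - d' - f s b'' - s' * (w - b'' - b')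
        = d - d' + s * (w - b - b'') - s' * (w - b' - b'') + r" for s s'
      by (simp add: f_def algebra_simps)
    have "r' - r = d - d' + s * (w - b - b'') - s' * (w - b' - b'') \<longleftrightarrow>
        r' = w - d' - f s b'' - s' * (w - b'' - b')" for s s'
      unfolding diff_eq_eq[of r' r] e by (rule refl)
    then show ?thesis
      unfolding x y mem_Collect_eq colour_Cross L_sym[of a'' a'] f_def by auto
  qed
  show ?thesis
  proof (cases "a = a'")
    case aa: True
    show ?thesis
    proof (cases "b = b'")
      case True
      have cxy: "\<chi> x y = Within (r' - r)" using aa True by (simp add: x y point_colour.simps L_diag)
      show ?thesis
      proof (cases "r' - r = d - d'")
        case r: True
        have "?Z = (\<lambda>(a'', b''). (a'', b'', f (the (L a a'')) b'')) ` ((UNIV - {a}) \<times> UNIV)"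
        proof (rule Set.set_eqI)
          fix z :: "'a point"
          obtain a'' b'' r'' where z: "z = (a'', b'', r'')" by (cases z)
          show "z \<in> ?Z \<longleftrightarrow> z \<in> (\<lambda>(a'', b''). (a'', b'', f (the (L a a'')) b'')) ` ((UNIV - {a}) \<times> UNIV)"
            unfolding z Z using aa True r L_None[of a a''] by (auto simp: image_iff)
        qed
        also have "card \<dots> = card (UNIV - {a}) * q"
          by (subst card_image) (auto simp: inj_on_def card_cartesian_product)
        finally show ?thesis using cxy r by (simp add: card_option)
      next
        case False
        have "z \<notin> ?Z" for z
        proof -
          obtain a'' b'' r'' where z: "z = (a'', b'', r'')" by (cases z)
          show ?thesis unfolding z Z using False aa True by auto
        qed
        then have "?Z = {}" by blast
        then show ?thesis using cxy False by simp
      qed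
    next
      case False
      define s where "s = (d - d' - (r' - r)) / (b - b')"
      obtain a0 where a0: "L a a0 = Some s" using L_surj by blast
      have *: "r' - r = d - d' + t * (w - b - b'') - t * (w - b' - b'') \<longleftrightarrow> t = s" for t b''
    proof -
      have "d - d' + t * (w - b - b'') - t * (w - b' - b'') = d - d' - t * (b - b')"
        by (simp add: algebra_simps)
      then show ?thesis
        unfolding s_def using False by (simp add: eq_divide_eq) (auto simp: algebra_simps)
    qed
      have "?Z = (\<lambda>b''. (a0, b'', f s b'')) ` UNIV"
      proof (rule Set.set_eqI)
        fix z :: "'a point"
        obtain a'' b'' r'' where z: "z = (a'', b'', r'')" by (cases z)
        have "L a a'' = Some s \<longleftrightarrow> a'' = a0" using L_inj a0 by metis
        moreover have "z \<in> ?Z \<longleftrightarrow> (\<exists>t. L a a'' = Some t \<and> r'' = f t b'' \<and>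
            r' - r = d - d' + t * (w - b - b'') - t * (w - b' - b''))"
          unfolding z Z aa[symmetric] by auto
        ultimately show "z \<in> ?Z \<longleftrightarrow> z \<in> (\<lambda>b''. (a0, b'', f s b'')) ` UNIV"
          unfolding * z by auto
      qed
      also have "card \<dots> = q" by (subst card_image) (auto simp: inj_on_def)
      finally have "card ?Z = q" .
      moreover have "\<chi> x y = Group" using aa False by (simp add: x y point_colour.simps L_diag)
      ultimately show ?thesis by simp
    qed
  next
    case False
    (* The solution for b'' of the linear equation with distinct slopes. *)
    define g where "g s s' = (d - d' + s * (w - b) - s' * (w - b') - (r' - r)) / (s - s')" for s s'
    define F where "F a'' = (let s = the (L a a''); s' = the (L a' a'')
      in (a'', g s s', f s (g s s')))" for a''
    have *: "r' - r = d - d' + s * (w - b - b'') - s' * (w - b' - b'') \<longleftrightarrow> b'' = g s s'"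
      if "s \<noteq> s'" for s s' b''
    proof -
      have "d - d' + s * (w - b - b'') - s' * (w - b' - b'')
          = d - d' + s * (w - b) - s' * (w - b') - b'' * (s - s')"
        by (simp add: algebra_simps)
      then show ?thesis
        unfolding g_def using that by (simp add: eq_divide_eq) (auto simp: algebra_simps)
    qed
    have "?Z = F ` (UNIV - {a, a'})"
    proof (rule Set.set_eqI)
      fix z :: "'a point"
      obtain a'' b'' r'' where z: "z = (a'', b'', r'')" by (cases z)
      show "z \<in> ?Z \<longleftrightarrow> z \<in> F ` (UNIV - {a, a'})"
      proof (cases "a'' = a \<or> a'' = a'")
        case True
        then show ?thesis unfolding z Z by (auto simp: L_diag F_def Let_def)
      next
        case n: False
        then obtain s s' where s: "L a a'' = Some s" "L a' a'' = Some s'" using L_Some by metis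
        have "s \<noteq> s'" using s L_inj[of a'' a a'] False L_sym by metis
        moreover have "z \<in> F ` (UNIV - {a, a'}) \<longleftrightarrow> z = F a''"
          using n unfolding z by (auto simp: F_def Let_def)
        ultimately show ?thesis
          unfolding z Z using s *[of s s' b''] by (auto simp: F_def)
      qed
    qed
    also have "card \<dots> = card (UNIV - {a, a'})"
      by (subst card_image) (auto simp: inj_on_def F_def Let_def)
    also have "\<dots> = q - 1"
      using False by (subst card_Diff_subset) (auto simp: card_option)
    finally have "card ?Z = q - 1" .
    moreover obtain s where "L a a' = Some s" using L_Some False by blast
    then have "\<chi> x y = Cross (w - r - r' - s * (w - b - b'))"
      by (simp add: x y point_colour.simps)
    ultimately show ?thesis by simp
  qed
qed

text \<open>
  Reversing the path from \<open>x\<close> through \<open>z\<close> to \<open>y\<close> transposes both colours and exchanges them, which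
  reduces the remaining combinations of colours to those counted above.
\<close>

lemma coherent_swap:
  assumes "card {z. \<chi> y z = conv_colour l \<and> \<chi> z x = conv_colour k} = n (\<chi> y x)"
  shows "card {z. \<chi> x z = k \<and> \<chi> z y = l} = n (conv_colour (\<chi> x y))"
proof -
  have "\<chi> s t = k \<longleftrightarrow> \<chi> t s = conv_colour k" for s t k
    using colour_conv[of s t] conv_conv[of "\<chi> t s"] conv_conv[of k] by metis
  then have "{z. \<chi> x z = k \<and> \<chi> z y = l} = {z. \<chi> y z = conv_colour l \<and> \<chi> z x = conv_colour k}"
    by blast
  then show ?thesis using assms by (simp only: colour_conv[of y x])
qed

lemma coherent:
  "\<exists>n. \<forall>x y. card {z. \<chi> x z = k \<and> \<chi> z y = l} = n (\<chi> x y)"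
proof -
  define P where "P k l n \<longleftrightarrow> (\<forall>x y. card {z. \<chi> x z = k \<and> \<chi> z y = l} = n (\<chi> x y))" for k l n
  have P: "P k l n" if "\<And>x y. card {z. \<chi> x z = k \<and> \<chi> z y = l} = n (\<chi> x y)" for k l n
    unfolding P_def by (intro allI that)
  have swap: "P k l (\<lambda>t. n (conv_colour t))" if "P (conv_colour l) (conv_colour k) n" for k l n
    by (rule P, rule coherent_swap) (use that[unfolded P_def] in blast)
  have Within_any: "P (Within d) l (\<lambda>t. of_bool (t = shift_colour d l))" for d l
    by (rule P) (rule card_Within)
  have Cross_Group: "P (Cross d) Group (\<lambda>t. case t of Cross d \<Rightarrow> q - 1 | _ \<Rightarrow> 0)" for d
    by (rule P) (rule card_Cross_Group)
  have Group_Group: "P Group Group (\<lambda>t. case t of Within d \<Rightarrow> (q - 1) * q | Group \<Rightarrow> (q - 2) * q | Cross d \<Rightarrow> 0)"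
    by (rule P) (rule card_Group_Group)
  have Cross_Cross: "P (Cross d) (Cross d') (\<lambda>t. case t of
      Within g \<Rightarrow> if g = d - d' then q * q else 0 | Group \<Rightarrow> q | Cross g \<Rightarrow> q - 1)" for d d'
    by (rule P) (rule card_Cross_Cross)
  have "\<exists>n. P k l n"
  proof (cases k)
    case (Within d)
    show ?thesis unfolding Within by (rule exI, rule Within_any)
  next
    case k: Group
    show ?thesis
    proof (cases l)
      case (Within d)
      show ?thesis unfolding k Within
        by (rule exI, rule swap, unfold conv_colour.simps, rule Within_any)
    next
      case Group
      show ?thesis unfolding k Group by (rule exI, rule Group_Group)
    next
      case (Cross d)
      show ?thesis unfolding k Cross
        by (rule exI, rule swap, unfold conv_colour.simps, rule Cross_Group)
    qed
  next
    case k: (Cross d)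
    show ?thesis
    proof (cases l)
      case (Within d)
      show ?thesis unfolding k Within
        by (rule exI, rule swap, unfold conv_colour.simps, rule Within_any)
    next
      case Group
      show ?thesis unfolding k Group by (rule exI, rule Cross_Group)
    next
      case (Cross d')
      show ?thesis unfolding k Cross by (rule exI, rule Cross_Cross)
    qed
  qed
  then show ?thesis unfolding P_def .
qed

end

section \<open>Lexicographic order and the matrices of translations\<close>

text \<open>
  The most significant digit comes first. This is at once the lexicographic order on lists of equal
  length and the order of the row indices of an iterated Kronecker product.
\<close>

fun digits_value :: "nat \<Rightarrow> nat list \<Rightarrow> nat" where
  "digits_value p [] = 0"
| "digits_value p (x # xs) = x * p ^ length xs + digits_value p xs"

lemma digits_value_less:
  "set xs \<subseteq> {0..<p} \<Longrightarrow> digits_value p xs < p ^ length xs"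
proof (induction xs)
  case (Cons x xs)
  then have "x < p" "digits_value p xs < p ^ length xs" by auto
  then have "x * p ^ length xs + digits_value p xs < (x + 1) * p ^ length xs" by simp
  also have "\<dots> \<le> p * p ^ length xs" using \<open>x < p\<close> by (intro mult_right_mono) auto
  finally show ?case by simp
qed simp

lemma digits_value_mono:
  assumes "length xs = length ys" "set xs \<subseteq> {0..<p}" "set ys \<subseteq> {0..<p}"
    and "(xs, ys) \<in> lexord less_than"
  shows "digits_value p xs < digits_value p ys"
  using assms
proof (induction xs ys rule: list_induct2)
  case (Cons x xs y ys)
  show ?case
  proof (cases "x = y")
    case True
    then show ?thesis using Cons by auto
  next
    case False
    then have "x < y" using Cons.prems by auto
    have "x * p ^ length xs + digits_value p xs < (x + 1) * p ^ length xs"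
      using digits_value_less[of xs p] Cons.prems by simp
    also have "\<dots> \<le> y * p ^ length xs" using \<open>x < y\<close> by (intro mult_right_mono) auto
    finally show ?thesis using Cons.hyps by simp
  qed
qed simp

lemma lexord_less_than_iff_digits_value:
  assumes "length xs = length ys" "set xs \<subseteq> {0..<p}" "set ys \<subseteq> {0..<p}"
  shows "(xs, ys) \<in> lexord less_than \<longleftrightarrow> digits_value p xs < digits_value p ys"
proof -
  have "(xs, ys) \<in> lexord less_than \<or> xs = ys \<or> (ys, xs) \<in> lexord less_than"
    by (rule lexord_linear) auto
  then show ?thesis using digits_value_mono[of xs ys p] digits_value_mono[of ys xs p] assms by auto
qed

lemma digits_value_inj:
  assumes "length xs = length ys" "set xs \<subseteq> {0..<p}" "set ys \<subseteq> {0..<p}"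
    and "digits_value p xs = digits_value p ys"
  shows "xs = ys"
proof -
  have "(xs, ys) \<in> lexord less_than \<or> xs = ys \<or> (ys, xs) \<in> lexord less_than"
    by (rule lexord_linear) auto
  then show ?thesis
    using assms lexord_less_than_iff_digits_value[of xs ys p]
      lexord_less_than_iff_digits_value[of ys xs p] by auto
qed

text \<open>
  Reversing the order of all numbers below \<open>p ^ n\<close> complements each digit.
\<close>

lemma digits_value_complement:
  assumes "set xs \<subseteq> {0..<p}"
  shows "digits_value p (map (\<lambda>d. p - 1 - d) xs) + digits_value p xs + 1 = p ^ length xs"
  using assms
proof (induction xs)
  case (Cons x xs)
  let ?P = "p ^ length xs"
  have x: "x < p" using Cons.prems by simp
  have "digits_value p (map (\<lambda>d. p - 1 - d) (x # xs)) + digits_value p (x # xs) + 1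
      = (p - 1 - x) * ?P + x * ?P + (digits_value p (map (\<lambda>d. p - 1 - d) xs) + digits_value p xs + 1)"
    by simp
  also have "\<dots> = ((p - 1 - x) + x + 1) * ?P" using Cons by (simp only: distrib_right) simp
  also have "\<dots> = p ^ length (x # xs)" using x by simp
  finally show ?case .
qed simp

lemma kronecker_index:
  "i < dim_row A * dim_row B \<Longrightarrow> j < dim_col A * dim_col B \<Longrightarrow>
    (A \<otimes>\<^sub>k B) $$ (i, j) = A $$ (i div dim_row B, j div dim_col B) * B $$ (i mod dim_row B, j mod dim_col B)"
  by (simp add: kronecker_def)

lemma kronecker_dim [simp]:
  "dim_row (A \<otimes>\<^sub>k B) = dim_row A * dim_row B" "dim_col (A \<otimes>\<^sub>k B) = dim_col A * dim_col B"
  by (simp_all add: kronecker_def)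

lemma circulant_U_carrier [simp]: "circulant_U p \<in> carrier_mat p p"
  by (simp add: circulant_U_def)

lemma circulant_U_dim [simp]: "dim_row (circulant_U p) = p" "dim_col (circulant_U p) = p"
  by (simp_all add: circulant_U_def)

lemma circulant_U_pow_index:
  assumes "i < p" "j < p"
  shows "(circulant_U p ^\<^sub>m k) $$ (i, j) = of_bool (j = (i + k) mod p)"
  using assms
proof (induction k arbitrary: j)
  case 0
  then show ?case by (auto simp: circulant_U_def)
next
  case (Suc k)
  let ?U = "circulant_U p"
  have d: "?U ^\<^sub>m k \<in> carrier_mat p p" by simp
  have "(?U ^\<^sub>m Suc k) $$ (i, j) = (\<Sum>s\<in>{0..<p}. (?U ^\<^sub>m k) $$ (i, s) * ?U $$ (s, j))"
    using Suc.prems d by (simp add: scalar_prod_def circulant_U_def)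
  also have "\<dots> = (\<Sum>s\<in>{0..<p}. if s = (i + k) mod p then of_bool (j = (s + 1) mod p) else 0)"
    using Suc by (intro sum.cong) (auto simp: circulant_U_def)
  also have "\<dots> = of_bool (j = ((i + k) mod p + 1) mod p)" using Suc.prems by simp
  also have "((i + k) mod p + 1) mod p = (i + Suc k) mod p" by (simp add: mod_simps)
  finally show ?case .
qed

lemma foldr_kronecker_dim:
  "foldr (\<lambda>k M. (circulant_U p ^\<^sub>m k) \<otimes>\<^sub>k M) ks (1\<^sub>m 1) \<in> carrier_mat (p ^ length ks) (p ^ length ks)"
proof (induction ks)
  case (Cons k ks)
  have "circulant_U p ^\<^sub>m k \<in> carrier_mat p p" by simp
  then show ?case using Cons by (intro carrier_matI) auto
qed simp

text \<open>
  Splitting an index by \<open>div\<close> and \<open>mod\<close> of the size of the second factor separates the leading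
  digit from the rest, so each factor of the product acts on its own digit by a cyclic shift.
\<close>

lemma foldr_kronecker_index:
  assumes "length xs = length ks" "length ys = length ks" "set xs \<subseteq> {0..<p}" "set ys \<subseteq> {0..<p}"
  shows "foldr (\<lambda>k M. (circulant_U p ^\<^sub>m k) \<otimes>\<^sub>k M) ks (1\<^sub>m 1) $$ (digits_value p xs, digits_value p ys)
    = of_bool (ys = map2 (\<lambda>i j. (i + j) mod p) xs ks)"
  using assms
proof (induction ks arbitrary: xs ys)
  case (Cons k ks)
  obtain x xs' y ys' where xy: "xs = x # xs'" "ys = y # ys'"
    using Cons.prems by (metis length_Suc_conv)
  define M where "M = foldr (\<lambda>k M. (circulant_U p ^\<^sub>m k) \<otimes>\<^sub>k M) ks (1\<^sub>m 1)"
  have M: "dim_row M = p ^ length ks" "dim_col M = p ^ length ks"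
    unfolding M_def using foldr_kronecker_dim[of p ks] by auto
  have U: "dim_row (circulant_U p ^\<^sub>m k) = p" "dim_col (circulant_U p ^\<^sub>m k) = p"
    using pow_carrier_mat[OF circulant_U_carrier, of p k] by auto
  have len: "length xs' = length ks" "length ys' = length ks" using Cons.prems xy by auto
  have lt: "digits_value p xs' < p ^ length ks" "digits_value p ys' < p ^ length ks"
    using digits_value_less[of xs' p] digits_value_less[of ys' p] Cons.prems xy len by auto
  have lt': "digits_value p xs < p * p ^ length ks" "digits_value p ys < p * p ^ length ks"
    using digits_value_less[of xs p] digits_value_less[of ys p] Cons.prems by auto
  have "foldr (\<lambda>k M. (circulant_U p ^\<^sub>m k) \<otimes>\<^sub>k M) (k # ks) (1\<^sub>m 1) $$ (digits_value p xs, digits_value p ys)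
     = ((circulant_U p ^\<^sub>m k) \<otimes>\<^sub>k M) $$ (digits_value p xs, digits_value p ys)"
    by (simp add: M_def)
  also have "\<dots> = (circulant_U p ^\<^sub>m k) $$ (x, y) * M $$ (digits_value p xs', digits_value p ys')"
  proof -
    have "p ^ length ks > 0" using lt(1) by (rule le_less_trans[OF le0])
    then have "digits_value p xs div p ^ length ks = x" "digits_value p ys div p ^ length ks = y"
      "digits_value p xs mod p ^ length ks = digits_value p xs'"
      "digits_value p ys mod p ^ length ks = digits_value p ys'"
      using lt by (simp_all add: xy len)
    then show ?thesis using lt' by (subst kronecker_index) (simp_all add: M U)
  qed
  also have "\<dots> = of_bool (y = (x + k) mod p) * of_bool (ys' = map2 (\<lambda>i j. (i + j) mod p) xs' ks)"
    using Cons.prems xy Cons.IH[OF len] by (simp add: circulant_U_pow_index M_def)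
  also have "\<dots> = of_bool (ys = map2 (\<lambda>i j. (i + j) mod p) xs (k # ks))" by (simp add: xy)
  finally show ?case .
qed simp

locale lex_coordinates =
  fixes p m q :: nat and c :: "'a::{field,finite} \<Rightarrow> nat list"
  assumes coords: "coordinates p m c" and q_eq: "q = p ^ m" and p_pos: "p > 0"
begin

lemma c_bij: "bij_betw c UNIV {xs. length xs = m \<and> set xs \<subseteq> {0..<p}}"
  using coords by (simp add: coordinates_def)

lemma c_add: "c (x + y) = map2 (\<lambda>i j. (i + j) mod p) (c x) (c y)"
  using coords by (simp add: coordinates_def)

lemma c_length: "length (c x) = m" and c_digits: "set (c x) \<subseteq> {0..<p}"
  using bij_betw_apply[OF c_bij, of x] by simp_all

lemma c_inj: "c x = c y \<longleftrightarrow> x = y"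
  using bij_betw_imp_inj_on[OF c_bij] by (simp add: inj_eq)

lemma c_surj:
  assumes "length xs = m" "set xs \<subseteq> {0..<p}"
  obtains x where "c x = xs"
  using assms bij_betw_imp_surj_on[OF c_bij] by (metis (mono_tags, lifting) imageE mem_Collect_eq)

lemma card_UNIV_eq: "card (UNIV :: 'a set) = q"
proof -
  have "card (UNIV :: 'a set) = card {xs. set xs \<subseteq> {0..<p} \<and> length xs = m}"
    using bij_betw_same_card[OF c_bij] by (simp add: conj_commute)
  then show ?thesis by (simp add: card_lists_length_eq q_eq)
qed

definition pos :: "'a \<Rightarrow> nat" where "pos x = digits_value p (c x)"

lemma pos_bij: "bij_betw pos UNIV {0..<q}"
proof -
  have inj: "inj pos"
    by (rule injI) (metis c_digits c_inj c_length digits_value_inj pos_def)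
  have "pos ` UNIV \<subseteq> {0..<q}"
    using digits_value_less[OF c_digits] by (auto simp: pos_def c_length q_eq)
  moreover have "card (pos ` UNIV) = card {0..<q}"
    using inj by (simp add: card_image card_UNIV_eq)
  ultimately have "pos ` UNIV = {0..<q}" by (simp add: card_subset_eq)
  then show ?thesis using inj by (simp add: bij_betw_def)
qed

text \<open>
  Ranks are values of coordinate lists because these values fill an initial segment of the naturals.
\<close>

lemma lex_rank_eq: "lex_rank c x = pos x"
proof -
  have "bij_betw pos {y. pos y < pos x} {0..<pos x}"
  proof (rule bij_betw_subset[OF pos_bij])
    have "pos x < q" using pos_bij by (auto simp: bij_betw_def)
    then have "t \<in> pos ` {y. pos y < pos x}" if "t < pos x" for t
      using that pos_bij by (auto simp: bij_betw_def set_eq_iff image_iff)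
        (metis order.strict_trans)
    then show "pos ` {y. pos y < pos x} = {0..<pos x}" by auto
  qed simp
  moreover have "{y. (c y, c x) \<in> lexord less_than} = {y. pos y < pos x}"
    unfolding pos_def using lexord_less_than_iff_digits_value[OF _ c_digits c_digits] c_length
    by simp
  ultimately show ?thesis unfolding lex_rank_def using bij_betw_same_card by fastforce
qed

lemma nth_elem_pos [simp]: "nth_elem c (pos x) = x"
  unfolding nth_elem_def lex_rank_eq using pos_bij by (auto simp: bij_betw_def inj_on_def)

lemma pos_nth_elem [simp]: "k < q \<Longrightarrow> pos (nth_elem c k) = k"
  using pos_bij by (metis atLeastLessThan_iff bij_betw_imp_surj_on imageE le0 nth_elem_pos)

text \<open>
  Complementing the digits of \<open>x\<close> gives the digits of \<open>w - x\<close>, where all digits of the last element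
  \<open>w\<close> are \<open>p - 1\<close>: adding a digit and its complement produces no carry. So reversal of the
  enumeration is a reflection of the additive group.
\<close>

lemma nth_elem_reverse:
  assumes "k < q"
  shows "nth_elem c (q - 1 - k) = nth_elem c (q - 1) - nth_elem c k"
proof -
  define x where "x = nth_elem c k"
  have comp: "set (map (\<lambda>d. p - 1 - d) ds) \<subseteq> {0..<p}" if "set ds \<subseteq> {0..<p}" for ds
    using that by auto
  obtain y where y: "c y = map (\<lambda>d. p - 1 - d) (c x)"
    by (rule c_surj[of "map (\<lambda>d. p - 1 - d) (c x)"]) (use comp c_length c_digits in auto)
  have "pos y + pos x + 1 = q"
    using digits_value_complement[OF c_digits] by (simp add: pos_def y q_eq c_length)
  then have posy: "pos y = q - 1 - k" using assms by (simp add: x_def)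
  have "map2 (\<lambda>i j. (i + j) mod p) (map (\<lambda>d. p - 1 - d) xs) xs = replicate (length xs) (p - 1)"
    if "set xs \<subseteq> {0..<p}" for xs
    using that by (induction xs) auto
  then have "c (y + x) = replicate m (p - 1)"
    using c_digits c_length by (simp add: c_add y)
  moreover have "c (nth_elem c (q - 1)) = replicate m (p - 1)"
  proof -
    obtain u where u: "c u = replicate m (p - 1)"
      by (rule c_surj[of "replicate m (p - 1)"]) (use p_pos in \<open>auto simp: set_replicate_conv_if\<close>)
    have "digits_value p (replicate m 0) = 0" by (induction m) auto
    then have "pos u + 1 = q"
      using digits_value_complement[of "replicate m 0" p] p_pos
      by (simp add: pos_def u q_eq set_replicate_conv_if)
    then have "q - 1 = pos u" by simp
    then show ?thesis by (simp add: u)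
  qed
  ultimately have "y + x = nth_elem c (q - 1)" using c_inj by metis
  moreover have "nth_elem c (q - 1 - k) = y" using posy by (metis nth_elem_pos)
  ultimately show ?thesis by (simp add: x_def algebra_simps)
qed

lemma phi_carrier: "phi p c x \<in> carrier_mat q q"
  unfolding phi_def q_eq using foldr_kronecker_dim[of p "c x"] by (simp add: c_length)

lemma phi_index:
  assumes "i < q" "j < q"
  shows "phi p c x $$ (i, j) = of_bool (nth_elem c j = nth_elem c i + x)"
proof -
  have "phi p c x $$ (pos (nth_elem c i), pos (nth_elem c j))
      = of_bool (c (nth_elem c j) = c (nth_elem c i + x))"
    unfolding phi_def pos_def c_add
    by (rule foldr_kronecker_index) (auto simp: c_length dest: subsetD[OF c_digits])
  then show ?thesis using assms by (simp add: c_inj)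
qed

end

section \<open>The matrices as colour matrices\<close>

lemma mod_square_div: "(i mod q\<^sup>2) div q = (i div q) mod q" for q :: nat
  by (cases "q = 0") (simp_all add: power2_eq_square mod_mult2_eq)

lemma mod_square_mod: "(i mod q\<^sup>2) mod q = i mod q" for q :: nat
  by (simp add: power2_eq_square mod_mult2_eq)

text \<open>
  The back identity of order \<open>q\<^sup>2\<close> reverses both the blocks and the positions inside them.
\<close>

lemma reverse_div_mod:
  fixes q t :: nat
  assumes "t < q\<^sup>2"
  shows "(q\<^sup>2 - 1 - t) div q = q - 1 - t div q" "(q\<^sup>2 - 1 - t) mod q = q - 1 - t mod q"
proof -
  have q: "q > 0" using assms by (cases q) auto
  define u v where "u = t div q" and "v = t mod q"
  have t: "t = q * u + v" by (simp add: u_def v_def)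
  have v: "v < q" using q by (simp add: v_def)
  have u: "u < q" using assms by (simp add: u_def power2_eq_square less_mult_imp_div_less)
  obtain u' v' where uv: "q = Suc (u + u')" "q = Suc (v + v')"
    using u v by (metis add_Suc_right less_imp_Suc_add)
  have "q * q = q * Suc (u + u')" using uv(1) by simp
  also have "\<dots> = q * u + q * u' + q" by (simp add: distrib_left)
  finally have "q * q = q * u + q * u' + Suc (v + v')" using uv(2) by linarith
  then have "q\<^sup>2 - 1 - t = q * u' + v'" by (simp add: t power2_eq_square)
  moreover have "v' < q" using uv(2) by simp
  moreover have "q - 1 - u = u'" "q - 1 - v = v'" using uv by simp_all
  ultimately show "(q\<^sup>2 - 1 - t) div q = q - 1 - t div q" "(q\<^sup>2 - 1 - t) mod q = q - 1 - t mod q"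
    using q by (simp_all flip: u_def v_def)
qed

lemma mult_back_identity_index:
  assumes "A \<in> carrier_mat n n" "i < n" "j < n"
  shows "(A * back_identity_mat n) $$ (i, j) = A $$ (i, n - 1 - j)"
proof -
  have "(A * back_identity_mat n) $$ (i, j) = row A i \<bullet> col (back_identity_mat n) j"
    using assms by (simp add: back_identity_mat_def)
  also have "\<dots> = (\<Sum>s\<in>{0..<n}. if s = n - 1 - j then A $$ (i, s) else 0)"
    unfolding scalar_prod_def using assms
    by (intro sum.cong) (auto simp: back_identity_mat_def)
  also have "\<dots> = A $$ (i, n - 1 - j)" using assms by simp
  finally show ?thesis .
qed

text \<open>
  The reflection constant \<open>w\<close> of the colouring is the last element of the enumeration.
\<close>

locale latin_square_scheme =
  lex_coordinates p m q c + symmetric_latin_square L "nth_elem c (q - 1)" q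
  for p m q :: nat and c :: "'a::{field,finite} \<Rightarrow> nat list"
    and L :: "'a option \<Rightarrow> 'a option \<Rightarrow> 'a option" +
  fixes e :: "nat \<Rightarrow> 'a option"
  assumes e_bij: "bij_betw e {0..<q + 1} UNIV"
begin

abbreviation "v \<equiv> (q + 1) * q\<^sup>2"

definition point_of :: "nat \<Rightarrow> 'a point" where
  "point_of i = (e (i div q\<^sup>2), nth_elem c ((i div q) mod q), nth_elem c (i mod q))"

lemma q_pos: "q > 0"
  using q_eq p_pos by simp

lemma nth_elem_inj: "i < q \<Longrightarrow> j < q \<Longrightarrow> nth_elem c i = nth_elem c j \<longleftrightarrow> i = j"
  by (metis pos_nth_elem)

lemma e_inj: "i < q + 1 \<Longrightarrow> j < q + 1 \<Longrightarrow> e i = e j \<longleftrightarrow> i = j"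
  using e_bij by (auto simp: bij_betw_def inj_on_def)

lemma index_bounds:
  assumes "i < v"
  shows "i div q\<^sup>2 < q + 1" "(i div q) mod q < q" "i mod q < q" "i mod q\<^sup>2 < q\<^sup>2" "i div q < q * (q + 1)"
proof -
  show "i div q\<^sup>2 < q + 1" using assms by (rule less_mult_imp_div_less)
  have "v = q * (q + 1) * q" by (simp add: power2_eq_square algebra_simps)
  then show "i div q < q * (q + 1)" using assms by (intro less_mult_imp_div_less) simp
qed (use q_pos in simp_all)

lemma div_eq_iff: "i div q = j div q \<longleftrightarrow> i div q\<^sup>2 = j div q\<^sup>2 \<and> (i div q) mod q = (j div q) mod q"
  by (metis div_mult2_eq div_mult_mod_eq power2_eq_square)

lemma point_of_bij: "bij_betw point_of {0..<v} UNIV"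
proof -
  have inj: "inj_on point_of {0..<v}"
  proof (rule inj_onI)
    fix i j assume ij: "i \<in> {0..<v}" "j \<in> {0..<v}" and eq: "point_of i = point_of j"
    have b: "i < v" "j < v" using ij by auto
    have "i div q\<^sup>2 = j div q\<^sup>2" "(i div q) mod q = (j div q) mod q" "i mod q = j mod q"
      using eq b index_bounds by (auto simp: point_of_def nth_elem_inj e_inj)
    then show "i = j" by (metis div_eq_iff div_mult_mod_eq)
  qed
  have "card (UNIV :: 'a point set) = v"
    unfolding UNIV_Times_UNIV[symmetric] card_cartesian_product
    by (simp add: card_option power2_eq_square)
  then have "point_of ` {0..<v} = UNIV"
    using inj by (intro card_subset_eq) (simp_all add: card_image)
  then show ?thesis using inj by (simp add: bij_betw_def)
qed

lemma A0_mat_eq: "A0_mat p q c d = colour_mat v point_of \<chi> (Within d)"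
proof (rule eq_matI)
  have dim: "dim_row (phi p c d) = q" "dim_col (phi p c d) = q" using phi_carrier by auto
  have v: "q * (q + 1) * q = v" by (simp add: power2_eq_square algebra_simps)
  show "dim_row (A0_mat p q c d) = dim_row (colour_mat v point_of \<chi> (Within d))"
    "dim_col (A0_mat p q c d) = dim_col (colour_mat v point_of \<chi> (Within d))"
    unfolding A0_mat_def by (simp_all add: dim power2_eq_square algebra_simps)
  fix i j
  assume "i < dim_row (colour_mat v point_of \<chi> (Within d))"
    "j < dim_col (colour_mat v point_of \<chi> (Within d))"
  then have ij: "i < v" "j < v" by simp_all
  note b = index_bounds[OF ij(1)] index_bounds[OF ij(2)]
  have "A0_mat p q c d $$ (i, j)
      = 1\<^sub>m (q * (q + 1)) $$ (i div q, j div q) * phi p c d $$ (i mod q, j mod q)"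
    unfolding A0_mat_def
    by (subst kronecker_index) (use ij v in \<open>simp_all only: dim index_one_mat\<close>)
  also have "\<dots> = of_bool (i div q = j div q \<and> nth_elem c (j mod q) = nth_elem c (i mod q) + d)"
    using b by (simp add: phi_index)
  also have "\<dots> = of_bool (\<chi> (point_of i) (point_of j) = Within d)"
    unfolding point_of_def colour_Within div_eq_iff using b by (simp add: nth_elem_inj e_inj)
  finally show "A0_mat p q c d $$ (i, j) = colour_mat v point_of \<chi> (Within d) $$ (i, j)"
    using ij by simp
qed

lemma C_x_index: "s < q\<^sup>2 \<Longrightarrow> t < q\<^sup>2 \<Longrightarrow> C_x q $$ (s, t) = of_bool (s div q \<noteq> t div q)"
  unfolding C_x_def using q_pos
  by (simp add: all_ones_mat_def kronecker_index power2_eq_square less_mult_imp_div_less)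

lemma C_x_dim [simp]: "dim_row (C_x q) = q\<^sup>2" "dim_col (C_x q) = q\<^sup>2"
  by (simp_all add: C_x_def all_ones_mat_def power2_eq_square)

lemma A2_mat_eq: "A2_mat q = colour_mat v point_of \<chi> Group"
proof (rule eq_matI)
  show "dim_row (A2_mat q) = dim_row (colour_mat v point_of \<chi> Group)"
    "dim_col (A2_mat q) = dim_col (colour_mat v point_of \<chi> Group)"
    unfolding A2_mat_def by simp_all
  fix i j
  assume "i < dim_row (colour_mat v point_of \<chi> Group)" "j < dim_col (colour_mat v point_of \<chi> Group)"
  then have ij: "i < v" "j < v" by simp_all
  note b = index_bounds[OF ij(1)] index_bounds[OF ij(2)]
  have "A2_mat q $$ (i, j)
      = 1\<^sub>m (q + 1) $$ (i div q\<^sup>2, j div q\<^sup>2) * C_x q $$ (i mod q\<^sup>2, j mod q\<^sup>2)"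
    unfolding A2_mat_def
    by (subst kronecker_index) (use ij in \<open>simp_all only: C_x_dim index_one_mat\<close>)
  also have "\<dots> = of_bool (i div q\<^sup>2 = j div q\<^sup>2 \<and> (i div q) mod q \<noteq> (j div q) mod q)"
    using b by (simp add: C_x_index mod_square_div)
  also have "\<dots> = of_bool (\<chi> (point_of i) (point_of j) = Group)"
    unfolding point_of_def colour_Group using b by (simp add: nth_elem_inj e_inj)
  finally show "A2_mat q $$ (i, j) = colour_mat v point_of \<chi> Group $$ (i, j)"
    using ij by simp
qed

lemma C_block_reversed_index:
  assumes st: "s < q\<^sup>2" "t < q\<^sup>2"
  shows "(C_block p q c a d * back_identity_mat (q\<^sup>2)) $$ (s, t) =
    of_bool (nth_elem c (q - 1) - nth_elem c (s mod q) - nth_elem c (t mod q)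
      - a * (nth_elem c (q - 1) - nth_elem c (s div q) - nth_elem c (t div q)) = d)"
proof -
  let ?w = "nth_elem c (q - 1)"
  have b: "t div q < q" "t mod q < q" "s mod q < q"
    using st q_pos by (simp_all add: power2_eq_square less_mult_imp_div_less)
  have C: "C_block p q c a d \<in> carrier_mat (q\<^sup>2) (q\<^sup>2)" by (simp add: C_block_def)
  have lt: "q\<^sup>2 - 1 - t < q\<^sup>2" using st by simp
  have lt': "q - 1 - t mod q < q" using q_pos by simp
  have "(C_block p q c a d * back_identity_mat (q\<^sup>2)) $$ (s, t)
      = C_block p q c a d $$ (s, q\<^sup>2 - 1 - t)"
    by (rule mult_back_identity_index[OF C st])
  also have "\<dots> = phi p c (a * (- nth_elem c (s div q) + nth_elem c (q - 1 - t div q)) + d)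
      $$ (s mod q, q - 1 - t mod q)"
    unfolding C_block_def using st(1) lt by (simp only: index_mat reverse_div_mod[OF st(2)] prod.case)
  also have "\<dots> = of_bool (?w - nth_elem c (t mod q) = nth_elem c (s mod q)
      + (a * (- nth_elem c (s div q) + (?w - nth_elem c (t div q))) + d))"
    unfolding phi_index[OF b(3) lt'] nth_elem_reverse[OF b(1)] nth_elem_reverse[OF b(2)]
    by (rule refl)
  also have "\<dots> = of_bool (?w - nth_elem c (s mod q) - nth_elem c (t mod q)
      - a * (?w - nth_elem c (s div q) - nth_elem c (t div q)) = d)"
    by (rule arg_cong[of _ _ of_bool]) (auto simp: algebra_simps)
  finally show ?thesis .
qed

text \<open>
  At an entry with outer position \<open>(l, l')\<close> only the summand \<open>a = L l l'\<close> contributes, and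
  none does when \<open>l = l'\<close>.
\<close>

lemma A1_mat_eq: "A1_mat p q c e L d = colour_mat v point_of \<chi> (Cross d)"
proof (rule eq_matI)
  show "dim_row (A1_mat p q c e L d) = dim_row (colour_mat v point_of \<chi> (Cross d))"
    "dim_col (A1_mat p q c e L d) = dim_col (colour_mat v point_of \<chi> (Cross d))"
    unfolding A1_mat_def by simp_all
  fix i j
  assume "i < dim_row (colour_mat v point_of \<chi> (Cross d))"
    "j < dim_col (colour_mat v point_of \<chi> (Cross d))"
  then have ij: "i < v" "j < v" by simp_all
  note b = index_bounds[OF ij(1)] index_bounds[OF ij(2)]
  let ?B = "\<lambda>a. C_block p q c a d * back_identity_mat (q\<^sup>2)"
  have Bdim: "dim_row (?B a) = q\<^sup>2" "dim_col (?B a) = q\<^sup>2" for a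
    by (simp_all add: C_block_def back_identity_mat_def)
  have Pdim: "dim_row (P_mat q e L a) = q + 1" "dim_col (P_mat q e L a) = q + 1" for a
    by (simp_all add: P_mat_def)
  have "A1_mat p q c e L d $$ (i, j)
      = (\<Sum>a\<in>UNIV. (P_mat q e L (Some a) \<otimes>\<^sub>k ?B a) $$ (i, j))"
    unfolding A1_mat_def N_mat_def using ij by (simp add: mat_sum_def)
  also have "\<dots> = (\<Sum>a\<in>UNIV. P_mat q e L (Some a) $$ (i div q\<^sup>2, j div q\<^sup>2)
      * ?B a $$ (i mod q\<^sup>2, j mod q\<^sup>2))"
    by (intro sum.cong refl, subst kronecker_index) (use ij in \<open>simp_all only: Bdim Pdim\<close>)
  also have "\<dots> = (\<Sum>a\<in>UNIV. of_bool (L (e (i div q\<^sup>2)) (e (j div q\<^sup>2)) = Some a \<and>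
      \<chi> (point_of i) (point_of j) = Cross d))"
  proof (intro sum.cong refl)
    fix a
    have "P_mat q e L (Some a) $$ (i div q\<^sup>2, j div q\<^sup>2)
        = of_bool (L (e (i div q\<^sup>2)) (e (j div q\<^sup>2)) = Some a)"
      using b by (simp add: P_mat_def)
    moreover have "?B a $$ (i mod q\<^sup>2, j mod q\<^sup>2) = of_bool (\<chi> (point_of i) (point_of j) = Cross d)"
      if "L (e (i div q\<^sup>2)) (e (j div q\<^sup>2)) = Some a"
      unfolding C_block_reversed_index[OF b(4) b(9)] mod_square_div mod_square_mod point_of_def
      by (simp add: point_colour.simps that)
    ultimately show "P_mat q e L (Some a) $$ (i div q\<^sup>2, j div q\<^sup>2) * ?B a $$ (i mod q\<^sup>2, j mod q\<^sup>2)
        = of_bool (L (e (i div q\<^sup>2)) (e (j div q\<^sup>2)) = Some a \<and>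
            \<chi> (point_of i) (point_of j) = Cross d)"
      by (cases "L (e (i div q\<^sup>2)) (e (j div q\<^sup>2)) = Some a") simp_all
  qed
  also have "\<dots> = of_bool (\<chi> (point_of i) (point_of j) = Cross d)"
  proof (cases "\<chi> (point_of i) (point_of j) = Cross d")
    case True
    then obtain a where "L (e (i div q\<^sup>2)) (e (j div q\<^sup>2)) = Some a"
      unfolding point_of_def colour_Cross by blast
    then show ?thesis using True by (simp add: of_bool_def)
  qed simp
  finally show "A1_mat p q c e L d $$ (i, j) = colour_mat v point_of \<chi> (Cross d) $$ (i, j)"
    using ij by simp
qed

section \<open>The scheme\<close>

lemma scheme_matrices:
  "range (A0_mat p q c) \<union> range (A1_mat p q c e L) \<union> {A2_mat q}
    = range (colour_mat v point_of \<chi>)"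
proof -
  have "colour_mat v point_of \<chi> k
      \<in> range (A0_mat p q c) \<union> range (A1_mat p q c e L) \<union> {A2_mat q}" for k
  proof (cases k)
    case (Within d)
    then show ?thesis using A0_mat_eq[of d] by (metis UnI1 rangeI)
  next
    case Group
    then show ?thesis using A2_mat_eq by (metis UnI2 singletonI)
  next
    case (Cross d)
    then show ?thesis using A1_mat_eq[of d] by (metis UnI1 UnI2 rangeI)
  qed
  then show ?thesis
    unfolding A0_mat_eq[abs_def] A1_mat_eq[abs_def] A2_mat_eq by blast
qed

lemma is_association_scheme: "association_scheme v (range (colour_mat v point_of \<chi>))"
proof (rule association_scheme_of_colouring[where conv = conv_colour and k\<^sub>0 = "Within 0"])
  show "bij_betw point_of {0..<v} UNIV" by (rule point_of_bij)
  show "\<exists>x y. \<chi> x y = k" for k by (rule colour_surj)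
  show "\<chi> x y = Within 0 \<longleftrightarrow> x = y" for x y by (rule colour_diag)
  show "\<chi> y x = conv_colour (\<chi> x y)" for x y by (rule colour_conv)
  show "conv_colour (conv_colour k) = k" for k :: "'a colour" by (rule conv_conv)
  show "\<exists>n. \<forall>x y. card {z. \<chi> x z = k \<and> \<chi> z y = l} = n (\<chi> x y)" for k l by (rule coherent)
qed

text \<open>
  Evaluated at a pair of points of colour \<open>Cross 1\<close>, the left product is 1, while the right product
  is supported on the colour \<open>Cross (- 1)\<close>.
\<close>

lemma noncommuting:
  assumes "odd q"
  shows "A0_mat p q c 1 * A1_mat p q c e L 0 \<noteq> A1_mat p q c e L 0 * A0_mat p q c 1"
proof
  assume eq: "A0_mat p q c 1 * A1_mat p q c e L 0 = A1_mat p q c e L 0 * A0_mat p q c 1"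
  obtain x y where xy: "\<chi> x y = Cross 1" using colour_surj by blast
  obtain i where i: "i < v" "point_of i = x" using point_of_bij by (rule bij_betw_index)
  obtain j where j: "j < v" "point_of j = y" using point_of_bij by (rule bij_betw_index)
  define n1 n2 where "n1 = card {z. \<chi> x z = Within 1 \<and> \<chi> z y = Cross 0}"
    and "n2 = card {z. \<chi> x z = Cross 0 \<and> \<chi> z y = Within 1}"
  have "n1 = of_bool (\<chi> x y = shift_colour 1 (Cross 0))"
    unfolding n1_def by (rule card_Within)
  then have n1: "n1 = 1" unfolding xy by simp
  have "card {z. \<chi> y z = conv_colour (Within 1) \<and> \<chi> z x = conv_colour (Cross 0)}
      = of_bool (\<chi> y x = shift_colour (- 1) (Cross 0))"
    unfolding conv_colour.simps by (rule card_Within)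
  then have "n2 = of_bool (conv_colour (\<chi> x y) = shift_colour (- 1) (Cross 0))"
    unfolding n2_def by (rule coherent_swap[where n = "\<lambda>t. of_bool (t = shift_colour (- 1) (Cross 0))"])
  then have n2: "n2 = of_bool ((1 :: 'a) = - 1)" unfolding xy by simp
  have "(A0_mat p q c 1 * A1_mat p q c e L 0) $$ (i, j) = (A1_mat p q c e L 0 * A0_mat p q c 1) $$ (i, j)"
    by (simp only: eq)
  then have "(of_nat n1 :: complex) = of_nat n2"
    unfolding A0_mat_eq A1_mat_eq colour_mat_mult_index[OF point_of_bij i(1) j(1)] i(2) j(2)
      n1_def n2_def .
  then have "n1 = n2" by (simp only: of_nat_eq_iff)
  then have "of_bool ((1 :: 'a) = - 1) = (1 :: nat)" unfolding n1 n2 by (rule sym)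
  then have "(1 :: 'a) = - 1" by (simp only: of_bool_eq_1_iff)
  then have "of_nat 2 = (0 :: 'a)" by (simp only: of_nat_numeral eq_neg_iff_add_eq_0 one_add_one)
  then have "CHAR('a) dvd 2" by (simp only: of_nat_eq_0_iff_char_dvd)
  then have "CHAR('a) = 1 \<or> CHAR('a) = 2"
    using two_is_prime_nat unfolding prime_nat_iff by blast
  then have "CHAR('a) = 2" by simp
  then have "2 dvd q" using CHAR_dvd_CARD[where ?'a = 'a] by simp
  then show False using assms by simp
qed

end

theorem theorem5p3:
  fixes p m q :: nat
    and c :: "'a::{field,finite} \<Rightarrow> nat list"
    and e :: "nat \<Rightarrow> 'a option"
    and L :: "'a option \<Rightarrow> 'a option \<Rightarrow> 'a option"
  assumes "prime p" and "odd p" and "m \<ge> 1" and "q = p ^ m"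
    and "card (UNIV :: 'a set) = q"
    and "coordinates p m c"
    and "bij_betw e {0..<q + 1} UNIV"
    and "latin_square L"
    and "\<And>a b. L a b = L b a"
    and "\<And>a. L a a = None"
  shows "noncommutative_scheme ((q + 1) * q\<^sup>2)
           (range (A0_mat p q c) \<union> range (A1_mat p q c e L) \<union> {A2_mat q})"
proof -
  interpret latin_square_scheme p m q c L e
  proof
    show "coordinates p m c" "q = p ^ m" "card (UNIV :: 'a set) = q" "latin_square L"
      "bij_betw e {0..<q + 1} UNIV" "L a b = L b a" "L a a = None" for a b
      by fact+
    show "p > 0" using assms(1) by (rule prime_gt_0_nat)
  qed
  have "association_scheme v (range (A0_mat p q c) \<union> range (A1_mat p q c e L) \<union> {A2_mat q})"
    unfolding scheme_matrices by (rule is_association_scheme)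
  moreover have "odd q" using assms by simp
  ultimately show ?thesis
    unfolding noncommutative_scheme_def commutative_scheme_def using noncommuting by blast
qed

end
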